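(* There exist monoids $M$ and $N$ and monoid homomorphisms $f\colon M\to N$ and $g\colon N\to M$ such that, when $M$ and $N$ are regarded as categories with a single object and $f$, $g$ as functors, $f$ is left adjoint to $g$, but $f$ is not an isomorphism.
   Context: A monoid is regarded as a category with exactly one object, whose morphisms are the elements of the monoid and whose composition is multiplication ($mm' = m\circ m'$); monoid homomorphisms (preserving $1$) are then exactly functors. Concretely, $f\colon M\to N$ is left adjoint to $g\colon N\to M$ iff there is a bijection of sets $\varphi\colon N\to M$ with $g(n)\varphi(n')m=\varphi(nn'f(m))$ for all $n,n'\in N$, $m\in M$. *)

theory Defs
  imports "HOL-Algebra.Group"
begin

record ('o, 'a) precat =
  Obj :: "'o set"
  Arr :: "'a set"
  Dom :: "'a \<Rightarrow> 'o"
  Cod :: "'a \<Rightarrow> 'o"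
  Ide :: "'o \<Rightarrow> 'a"
  Cmp :: "'a \<Rightarrow> 'a \<Rightarrow> 'a"

text \<open>\<open>Cmp C v u\<close> is the composite \<open>v \<circ> u\<close> (first \<open>u\<close>, then \<open>v\<close>); it is
  meaningful only if \<open>Cod C u = Dom C v\<close>.\<close>

definition Homset :: "('o, 'a) precat \<Rightarrow> 'o \<Rightarrow> 'o \<Rightarrow> 'a set" where
  "Homset C x y = {u \<in> Arr C. Dom C u = x \<and> Cod C u = y}"

definition is_category :: "('o, 'a) precat \<Rightarrow> bool" where
  "is_category C \<longleftrightarrow>
     (\<forall>u \<in> Arr C. Dom C u \<in> Obj C \<and> Cod C u \<in> Obj C) \<and>
     (\<forall>x \<in> Obj C. Ide C x \<in> Homset C x x) \<and>
     (\<forall>u \<in> Arr C. \<forall>v \<in> Arr C. Cod C u = Dom C v \<longrightarrow>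
        Cmp C v u \<in> Homset C (Dom C u) (Cod C v)) \<and>
     (\<forall>u \<in> Arr C. Cmp C u (Ide C (Dom C u)) = u \<and> Cmp C (Ide C (Cod C u)) u = u) \<and>
     (\<forall>u \<in> Arr C. \<forall>v \<in> Arr C. \<forall>w \<in> Arr C. Cod C u = Dom C v \<longrightarrow> Cod C v = Dom C w \<longrightarrow>
        Cmp C w (Cmp C v u) = Cmp C (Cmp C w v) u)"

record ('o, 'a, 'p, 'b) prefunctor =
  ObjMap :: "'o \<Rightarrow> 'p"
  ArrMap :: "'a \<Rightarrow> 'b"

definition is_functor ::
  "('o, 'a) precat \<Rightarrow> ('p, 'b) precat \<Rightarrow> ('o, 'a, 'p, 'b) prefunctor \<Rightarrow> bool" where
  "is_functor C D F \<longleftrightarrow>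
     is_category C \<and> is_category D \<and>
     (\<forall>x \<in> Obj C. ObjMap F x \<in> Obj D) \<and>
     (\<forall>u \<in> Arr C. ArrMap F u \<in> Homset D (ObjMap F (Dom C u)) (ObjMap F (Cod C u))) \<and>
     (\<forall>x \<in> Obj C. ArrMap F (Ide C x) = Ide D (ObjMap F x)) \<and>
     (\<forall>u \<in> Arr C. \<forall>v \<in> Arr C. Cod C u = Dom C v \<longrightarrow>
        ArrMap F (Cmp C v u) = Cmp D (ArrMap F v) (ArrMap F u))"

text \<open>\<open>F : C \<rightarrow> D\<close> is left adjoint to \<open>G : D \<rightarrow> C\<close>: there is a family of bijections
  \<open>\<phi> x y : D(F x, y) \<rightarrow> C(x, G y)\<close>, natural in \<open>x\<close> (along \<open>h : x' \<rightarrow> x\<close>) and in \<open>y\<close>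
  (along \<open>k : y \<rightarrow> y'\<close>).\<close>

definition left_adjoint ::
  "('o, 'a) precat \<Rightarrow> ('p, 'b) precat \<Rightarrow>
   ('o, 'a, 'p, 'b) prefunctor \<Rightarrow> ('p, 'b, 'o, 'a) prefunctor \<Rightarrow> bool" where
  "left_adjoint C D F G \<longleftrightarrow>
     is_functor C D F \<and> is_functor D C G \<and>
     (\<exists>\<phi> :: 'o \<Rightarrow> 'p \<Rightarrow> 'b \<Rightarrow> 'a.
        (\<forall>x \<in> Obj C. \<forall>y \<in> Obj D.
           bij_betw (\<phi> x y) (Homset D (ObjMap F x) y) (Homset C x (ObjMap G y))) \<and>
        (\<forall>x \<in> Obj C. \<forall>x' \<in> Obj C. \<forall>y \<in> Obj D. \<forall>y' \<in> Obj D.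
           \<forall>h \<in> Homset C x' x. \<forall>k \<in> Homset D y y'. \<forall>u \<in> Homset D (ObjMap F x) y.
             \<phi> x' y' (Cmp D k (Cmp D u (ArrMap F h))) =
             Cmp C (ArrMap G k) (Cmp C (\<phi> x y u) h)))"

definition monoid_cat :: "('a, 'm) monoid_scheme \<Rightarrow> (unit, 'a) precat" where
  "monoid_cat M =
     \<lparr>Obj = {()}, Arr = carrier M, Dom = (\<lambda>_. ()), Cod = (\<lambda>_. ()),
      Ide = (\<lambda>_. \<one>\<^bsub>M\<^esub>), Cmp = (\<lambda>m m'. m \<otimes>\<^bsub>M\<^esub> m')\<rparr>"

definition hom_functor :: "('a \<Rightarrow> 'b) \<Rightarrow> (unit, 'a, unit, 'b) prefunctor" where
  "hom_functor f = \<lparr>ObjMap = (\<lambda>_. ()), ArrMap = f\<rparr>"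

text \<open>The library's \<^const>\<open>hom\<close> does not require preservation of the unit.\<close>

definition monoid_hom ::
  "('a, 'm) monoid_scheme \<Rightarrow> ('b, 'n) monoid_scheme \<Rightarrow> ('a \<Rightarrow> 'b) set" where
  "monoid_hom M N = {f \<in> hom M N. f \<one>\<^bsub>M\<^esub> = \<one>\<^bsub>N\<^esub>}"

lemma is_category_monoid_cat: "monoid M \<Longrightarrow> is_category (monoid_cat M)"
  by (auto simp: is_category_def monoid_cat_def Homset_def monoid.m_assoc
      intro: monoid.m_closed)

lemma is_functor_hom_functor_iff:
  assumes "monoid M" "monoid N"
  shows "is_functor (monoid_cat M) (monoid_cat N) (hom_functor f) \<longleftrightarrow> f \<in> monoid_hom M N"
  using is_category_monoid_cat[OF assms(1)] is_category_monoid_cat[OF assms(2)]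
  by (auto simp: is_functor_def monoid_cat_def Homset_def hom_functor_def monoid_hom_def hom_def)

lemma left_adjoint_monoid_iff:
  fixes M :: "('a, 'm) monoid_scheme" and N :: "('b, 'n) monoid_scheme"
  assumes M: "monoid M" and N: "monoid N"
    and f: "f \<in> monoid_hom M N" and g: "g \<in> monoid_hom N M"
  shows "left_adjoint (monoid_cat M) (monoid_cat N) (hom_functor f) (hom_functor g) \<longleftrightarrow>
    (\<exists>\<phi>. bij_betw \<phi> (carrier N) (carrier M) \<and>
      (\<forall>n \<in> carrier N. \<forall>n' \<in> carrier N. \<forall>m \<in> carrier M.
         g n \<otimes>\<^bsub>M\<^esub> \<phi> n' \<otimes>\<^bsub>M\<^esub> m = \<phi> (n \<otimes>\<^bsub>N\<^esub> n' \<otimes>\<^bsub>N\<^esub> f m)))"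
    (is "?L \<longleftrightarrow> (\<exists>\<phi>. ?R \<phi>)")
proof -
  have fc: "m \<in> carrier M \<Longrightarrow> f m \<in> carrier N" for m
    using f by (auto simp: monoid_hom_def hom_def)
  have gc: "n \<in> carrier N \<Longrightarrow> g n \<in> carrier M" for n
    using g by (auto simp: monoid_hom_def hom_def)
  have "?L \<longleftrightarrow> (\<exists>\<phi> :: unit \<Rightarrow> unit \<Rightarrow> 'b \<Rightarrow> 'a. bij_betw (\<phi> () ()) (carrier N) (carrier M) \<and>
      (\<forall>m \<in> carrier M. \<forall>n \<in> carrier N. \<forall>n' \<in> carrier N.
         \<phi> () () (n \<otimes>\<^bsub>N\<^esub> (n' \<otimes>\<^bsub>N\<^esub> f m)) = g n \<otimes>\<^bsub>M\<^esub> (\<phi> () () n' \<otimes>\<^bsub>M\<^esub> m)))"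
    using is_functor_hom_functor_iff[OF M N, of f] is_functor_hom_functor_iff[OF N M, of g] f g
    by (simp add: left_adjoint_def monoid_cat_def Homset_def hom_functor_def)
  also have "\<dots> \<longleftrightarrow> (\<exists>\<phi> :: unit \<Rightarrow> unit \<Rightarrow> 'b \<Rightarrow> 'a. ?R (\<phi> () ()))"
  proof (intro ex_cong1 conj_cong refl)
    fix \<phi> :: "unit \<Rightarrow> unit \<Rightarrow> 'b \<Rightarrow> 'a"
    assume "bij_betw (\<phi> () ()) (carrier N) (carrier M)"
    then have "n \<in> carrier N \<Longrightarrow> \<phi> () () n \<in> carrier M" for n
      by (auto simp: bij_betw_def)
    then show "(\<forall>m \<in> carrier M. \<forall>n \<in> carrier N. \<forall>n' \<in> carrier N.
         \<phi> () () (n \<otimes>\<^bsub>N\<^esub> (n' \<otimes>\<^bsub>N\<^esub> f m)) = g n \<otimes>\<^bsub>M\<^esub> (\<phi> () () n' \<otimes>\<^bsub>M\<^esub> m)) \<longleftrightarrow>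
      (\<forall>n \<in> carrier N. \<forall>n' \<in> carrier N. \<forall>m \<in> carrier M.
         g n \<otimes>\<^bsub>M\<^esub> \<phi> () () n' \<otimes>\<^bsub>M\<^esub> m = \<phi> () () (n \<otimes>\<^bsub>N\<^esub> n' \<otimes>\<^bsub>N\<^esub> f m))"
      using monoid.m_assoc[OF M] monoid.m_assoc[OF N] fc gc by metis
  qed
  also have "\<dots> \<longleftrightarrow> (\<exists>\<phi>. ?R \<phi>)"
  proof
    assume "\<exists>\<phi>. ?R \<phi>"
    then obtain \<phi> where "?R \<phi>" ..
    then show "\<exists>\<phi> :: unit \<Rightarrow> unit \<Rightarrow> 'b \<Rightarrow> 'a. ?R (\<phi> () ())"
      by (intro exI[of _ "\<lambda>_ _. \<phi>"])
  qed blast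
  finally show ?thesis .
qed

end

theory Submission
  imports Defs
begin

text \<open>The free pointed set functor \<open>X \<mapsto> X + 1\<close> is left adjoint to the forgetful functor from
  pointed sets to sets. On the single infinite set \<open>\<nat>\<close> both functors can be seen at once,
  because \<open>\<nat> + 1 \<cong> \<nat>\<close>: the pointed set \<open>(\<nat>, 0)\<close> has underlying set \<open>\<nat>\<close> and is also
  free on \<open>\<nat>\<close>, the generators being included by \<open>Suc\<close>. So the adjunction restricts to the
  monoid of all self-maps of \<open>\<nat>\<close> and the monoid of self-maps fixing \<open>0\<close>, and the bijection
  \<open>n \<mapsto> n \<circ> Suc\<close> between them is the universal property of the free pointed set. The left
  adjoint misses the maps that send a nonzero number to \<open>0\<close>, for instance the counit, which
  is the predecessor function; hence it is not surjective.\<close>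

definition self_maps :: "(nat \<Rightarrow> nat) monoid" where
  "self_maps = \<lparr>carrier = UNIV, mult = (\<circ>), one = id\<rparr>"

definition pointed_self_maps :: "(nat \<Rightarrow> nat) monoid" where
  "pointed_self_maps = \<lparr>carrier = {n. n 0 = 0}, mult = (\<circ>), one = id\<rparr>"

definition adjoin_point :: "(nat \<Rightarrow> nat) \<Rightarrow> nat \<Rightarrow> nat" where
  "adjoin_point m = case_nat 0 (Suc \<circ> m)"

lemma adjoin_point_simps [simp]:
  "adjoin_point m 0 = 0" "adjoin_point m (Suc k) = Suc (m k)"
  by (simp_all add: adjoin_point_def)

lemma monoid_self_maps: "monoid self_maps"
  by (rule monoidI) (auto simp: self_maps_def)

lemma monoid_pointed_self_maps: "monoid pointed_self_maps"
  by (rule monoidI) (auto simp: pointed_self_maps_def)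

lemma adjoin_point_hom: "adjoin_point \<in> monoid_hom self_maps pointed_self_maps"
proof -
  have "adjoin_point (m \<circ> m') = adjoin_point m \<circ> adjoin_point m'" for m m'
  proof
    fix k show "adjoin_point (m \<circ> m') k = (adjoin_point m \<circ> adjoin_point m') k"
      by (cases k) simp_all
  qed
  moreover have "adjoin_point id = id"
  proof
    fix k show "adjoin_point id k = id k"
      by (cases k) simp_all
  qed
  ultimately show ?thesis
    by (auto simp: monoid_hom_def hom_def self_maps_def pointed_self_maps_def)
qed

lemma forget_point_hom: "id \<in> monoid_hom pointed_self_maps self_maps"
  by (auto simp: monoid_hom_def hom_def self_maps_def pointed_self_maps_def)

text \<open>A map fixing \<open>0\<close> is determined by its values on successors, and these are arbitrary.\<close>

lemma bij_betw_restrict_to_generators: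
  "bij_betw (\<lambda>n. n \<circ> Suc) (carrier pointed_self_maps) (carrier self_maps)"
proof (rule bij_betwI[where g = "case_nat 0"])
  fix n assume "n \<in> carrier pointed_self_maps"
  then show "case_nat 0 (n \<circ> Suc) = n"
    by (auto simp: pointed_self_maps_def fun_eq_iff split: nat.split)
qed (auto simp: self_maps_def pointed_self_maps_def fun_eq_iff)

lemma adjoin_point_left_adjoint:
  "left_adjoint (monoid_cat self_maps) (monoid_cat pointed_self_maps)
     (hom_functor adjoin_point) (hom_functor id)"
proof -
  have "id n \<circ> (n' \<circ> Suc) \<circ> m = (n \<circ> n' \<circ> adjoin_point m) \<circ> Suc" for n n' m :: "nat \<Rightarrow> nat"
    by (simp add: fun_eq_iff)
  then show ?thesis
    unfolding left_adjoint_monoid_iff[OF monoid_self_maps monoid_pointed_self_maps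
        adjoin_point_hom forget_point_hom]
    using bij_betw_restrict_to_generators
    by (intro exI[of _ "\<lambda>n. n \<circ> Suc"]) (simp add: self_maps_def pointed_self_maps_def)
qed

lemma adjoin_point_not_iso: "adjoin_point \<notin> iso self_maps pointed_self_maps"
proof
  assume "adjoin_point \<in> iso self_maps pointed_self_maps"
  then have "adjoin_point ` carrier self_maps = carrier pointed_self_maps"
    by (simp add: iso_def bij_betw_def)
  moreover have "(\<lambda>k. k - 1) \<in> carrier pointed_self_maps"
    by (simp add: pointed_self_maps_def)
  ultimately obtain m where "(\<lambda>k. k - 1) = adjoin_point m"
    by auto
  then have "Suc 0 - 1 = adjoin_point m (Suc 0)"
    by (rule fun_cong)
  then show False
    by simp
qed

theorem mainTheorem1:
  shows "\<exists>(M :: (nat \<Rightarrow> nat) monoid) (N :: (nat \<Rightarrow> nat) monoid) f g.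
    monoid M \<and> monoid N \<and> f \<in> monoid_hom M N \<and> g \<in> monoid_hom N M \<and>
    left_adjoint (monoid_cat M) (monoid_cat N) (hom_functor f) (hom_functor g) \<and>
    f \<notin> iso M N"
  using monoid_self_maps monoid_pointed_self_maps adjoin_point_hom forget_point_hom
    adjoin_point_left_adjoint adjoin_point_not_iso
  by blast

end
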